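(* Let $\gamma:[0,1]\to[0,1]^2$ be a continuous curve such that $\gamma(0)=(0,0)$, $\gamma(1)=(1,1)$, and $\gamma(t)\in(0,1)^2$ for all $t\in(0,1)$. Then for each $n\in\mathbb{N}$ there exist points $A_0,A_1,\ldots,A_{n+1}$ on $\gamma$ (i.e. in the image $\gamma([0,1])$) such that $A_0=(0,0)$, $A_{n+1}=(1,1)$, all the numbers $\pi_1(\overrightarrow{A_iA_{i+1}})$ and $\pi_2(\overrightarrow{A_iA_{i+1}})$, $i=0,\ldots,n$, are strictly positive, and the two finite sequences $\big(\pi_1(\overrightarrow{A_iA_{i+1}})\big)_{i=0}^{n}$ and $\big(\pi_2(\overrightarrow{A_iA_{i+1}})\big)_{i=0}^{n}$ are the same after a rearrangement (i.e. there is a permutation $\sigma$ of $\{0,\ldots,n\}$ with $\pi_1(\overrightarrow{A_iA_{i+1}})=\pi_2(\overrightarrow{A_{\sigma(i)}A_{\sigma(i)+1}})$ for all $i$).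
   Context: $\pi_1,\pi_2:\mathbb{R}^2\to\mathbb{R}$ denote the projections onto the $x$-axis and the $y$-axis, $\pi_1(a,b)=a$, $\pi_2(a,b)=b$. For points $A,B\in\mathbb{R}^2$, $\overrightarrow{AB}=B-A$. *)

theory Defs
  imports "HOL-Analysis.Analysis" "HOL-Combinatorics.Permutations"
begin

end

theory Submission
  imports Defs
begin

text \<open>
  Induction on \<open>n\<close>. If the curve meets the diagonal in an interior point \<open>(e, e)\<close>, take
  \<open>A\<^sub>1 = (e, e)\<close>, match the first increments with each other, and continue in the square
  \<open>[e, 1]\<^sup>2\<close> with the part of the curve after its last visit to the left and bottom sides of that
  square. For this to work the curve must be allowed to start anywhere on those two sides.

  Otherwise the curve stays on one side of the diagonal, say \<open>y < x\<close>, and a cyclic shift works: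
  we look for \<open>c > 0\<close> and points \<open>A\<^sub>i = (x\<^sub>i, y\<^sub>i)\<close> with \<open>y\<^sub>i\<^sub>+\<^sub>1 = x\<^sub>i + c\<close> for all \<open>i \<le> n\<close>. Such
  points exist by the Poincare-Miranda theorem, applied to \<open>c\<close> and the parameters of the points,
  and \<open>x\<^sub>i\<^sub>+\<^sub>1 > y\<^sub>i\<^sub>+\<^sub>1 = x\<^sub>i + c\<close> makes all increments positive.
\<close>

section \<open>The Poincare-Miranda theorem\<close>

lemma compact_countable_box:
  fixes a b :: "nat \<Rightarrow> real"
  shows "compact (Pi UNIV (\<lambda>i. {a i..b i}))"
proof -
  \<comment> \<open>Tychonoff's theorem.\<close>
  have "compactin (product_topology (\<lambda>i. euclidean) UNIV) (PiE UNIV (\<lambda>i. {a i..b i}))"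
    unfolding compactin_PiE by simp
  then show ?thesis
    by (simp add: euclidean_product_topology PiE_UNIV_domain)
qed

lemma tendsto_coordinatewise:
  fixes X :: "nat \<Rightarrow> nat \<Rightarrow> real"
  shows "X \<longlonglongrightarrow> z \<longleftrightarrow> (\<forall>i. (\<lambda>k. X k i) \<longlonglongrightarrow> z i)"
  using limitin_componentwise[of "\<lambda>_. euclidean" UNIV X z sequentially]
  by (simp add: euclidean_product_topology)

text \<open>Kuhn's combinatorial lemma, applied to ever finer grids, finds a small cell on whose
  vertices every \<open>f i\<close> takes both signs weakly. A limit of such cells exists by
  compactness and is a common zero by continuity. Points are functions on all of \<open>nat\<close>,
  so that the number \<open>n\<close> of equations can vary within one type.\<close>

lemma poincare_miranda:
  fixes f :: "nat \<Rightarrow> (nat \<Rightarrow> real) \<Rightarrow> real" and a b :: "nat \<Rightarrow> real" and n :: nat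
  defines "B \<equiv> Pi UNIV (\<lambda>i. {a i..b i})"
  assumes ab: "\<And>i. a i \<le> b i"
    and cont: "\<And>i. i < n \<Longrightarrow> continuous_on B (f i)"
    and lo: "\<And>i z. i < n \<Longrightarrow> z \<in> B \<Longrightarrow> z i = a i \<Longrightarrow> f i z \<le> 0"
    and hi: "\<And>i z. i < n \<Longrightarrow> z \<in> B \<Longrightarrow> z i = b i \<Longrightarrow> 0 \<le> f i z"
  obtains z where "z \<in> B" "\<And>i. i < n \<Longrightarrow> f i z = 0"
proof -
  \<comment> \<open>The grid point with index vector \<open>r\<close> when each side is cut into
    \<open>p\<close> pieces; coordinates from \<open>n\<close> on are pinned to
    \<open>a i\<close>.\<close>
  define pt where
    "pt p r i = a i + (b i - a i) * (if i < n then real (r i) / real p else 0)"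
    for p :: nat and r :: "nat \<Rightarrow> nat" and i
  have pt_B: "pt p r \<in> B" if "0 < p" "\<forall>i<n. r i \<le> p" for p r
  proof -
    have "a i \<le> pt p r i \<and> pt p r i \<le> b i" for i
    proof -
      have "0 \<le> (if i < n then real (r i) / real p else 0)" (is "0 \<le> ?w")
        and "(if i < n then real (r i) / real p else 0) \<le> 1"
        using that by auto
      then have "0 \<le> (b i - a i) * ?w" "(b i - a i) * ?w \<le> b i - a i"
        using ab[of i] by (simp_all add: mult_left_le)
      then show ?thesis by (simp add: pt_def)
    qed
    then show ?thesis by (auto simp: B_def)
  qed
  \<comment> \<open>The label is the sign of \<open>f i\<close>, except that it is forced to 0 on
    the lower face and to 1 on the upper one, as Kuhn's lemma demands. By \<open>lo\<close> and
    \<open>hi\<close> the forced labels still agree with the weak sign.\<close>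
  define lab where
    "lab p r i = (if r i = p \<or> r i \<noteq> 0 \<and> 0 \<le> f i (pt p r) then 1 else 0::nat)"
    for p r i
  have lab0: "f i (pt p r) \<le> 0" if "lab p r i = 0" "0 < p" "\<forall>i<n. r i \<le> p" "i < n" for p r i
  proof (cases "r i = 0")
    case True
    then show ?thesis
      using lo[OF \<open>i < n\<close> pt_B[OF that(2,3)]] by (simp add: pt_def)
  next
    case False
    then show ?thesis using that(1) by (auto simp: lab_def split: if_splits)
  qed
  have lab1: "0 \<le> f i (pt p r)" if "lab p r i \<noteq> 0" "0 < p" "\<forall>i<n. r i \<le> p" "i < n" for p r i
  proof (cases "r i = p")
    case True
    then show ?thesis
      using hi[OF \<open>i < n\<close> pt_B[OF that(2,3)]] \<open>i < n\<close> \<open>0 < p\<close> by (simp add: pt_def)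
  next
    case False
    then show ?thesis using that(1) by (auto simp: lab_def split: if_splits)
  qed
  \<comment> \<open>Here \<open>q\<close> is the least vertex of the cell, common to all
    \<open>i\<close>, while the vertices \<open>r\<close> and \<open>s\<close> depend on
    \<open>i\<close>. The grid size \<open>Suc k\<close> keeps \<open>p\<close> positive.\<close>
  have "\<exists>q. (\<forall>i<n. q i < Suc k) \<and> (\<forall>i<n. \<exists>r s.
      (\<forall>j<n. q j \<le> r j \<and> r j \<le> q j + 1) \<and> (\<forall>j<n. q j \<le> s j \<and> s j \<le> q j + 1) \<and>
      f i (pt (Suc k) r) \<le> 0 \<and> 0 \<le> f i (pt (Suc k) s))" for k
  proof -
    have binary: "\<forall>x. (\<forall>i<n. x i \<le> Suc k) \<longrightarrow> (\<forall>i<n. lab (Suc k) x i = 0 \<or> lab (Suc k) x i = 1)"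
      and lower: "\<forall>x. (\<forall>i<n. x i \<le> Suc k) \<longrightarrow> (\<forall>i<n. x i = 0 \<longrightarrow> lab (Suc k) x i = 0)"
      and upper: "\<forall>x. (\<forall>i<n. x i \<le> Suc k) \<longrightarrow> (\<forall>i<n. x i = Suc k \<longrightarrow> lab (Suc k) x i = 1)"
      by (simp_all add: lab_def)
    obtain q where q: "\<forall>i<n. q i < Suc k"
      and rs: "\<forall>i<n. \<exists>r s. (\<forall>j<n. q j \<le> r j \<and> r j \<le> q j + 1) \<and>
        (\<forall>j<n. q j \<le> s j \<and> s j \<le> q j + 1) \<and> lab (Suc k) r i \<noteq> lab (Suc k) s i"
      by (rule kuhn_lemma[OF zero_less_Suc binary lower upper])
    have "\<exists>r s. (\<forall>j<n. q j \<le> r j \<and> r j \<le> q j + 1) \<and> (\<forall>j<n. q j \<le> s j \<and> s j \<le> q j + 1) \<and>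
      f i (pt (Suc k) r) \<le> 0 \<and> 0 \<le> f i (pt (Suc k) s)" if i: "i < n" for i
    proof -
      obtain r s where r: "\<forall>j<n. q j \<le> r j \<and> r j \<le> q j + 1"
        and s: "\<forall>j<n. q j \<le> s j \<and> s j \<le> q j + 1"
        and ne: "lab (Suc k) r i \<noteq> lab (Suc k) s i"
        using rs i by blast
      have bd: "\<forall>j<n. u j \<le> Suc k" if u: "\<forall>j<n. q j \<le> u j \<and> u j \<le> q j + 1" for u
      proof (intro allI impI)
        fix j assume "j < n"
        then have "q j < Suc k" "u j \<le> q j + 1" using q u by blast+
        then show "u j \<le> Suc k" by simp
      qed
      note rp = bd[OF r] and sp = bd[OF s]
      show ?thesis
      proof (cases "lab (Suc k) r i = 0")
        case True
        then have "f i (pt (Suc k) r) \<le> 0" "0 \<le> f i (pt (Suc k) s)"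
          using ne lab0[OF True _ rp i] lab1[OF _ _ sp i] by simp_all
        with r s show ?thesis by (intro exI conjI)
      next
        case False
        have "lab (Suc k) s i = 0"
          using False ne by (auto simp: lab_def split: if_splits)
        then have "f i (pt (Suc k) s) \<le> 0" "0 \<le> f i (pt (Suc k) r)"
          using lab1[OF False _ rp i] lab0[OF _ _ sp i] by simp_all
        with r s show ?thesis by (intro exI conjI)
      qed
    qed
    with q show ?thesis by (intro exI[of _ q]) simp
  qed
  then obtain q where q: "\<And>k i. i < n \<Longrightarrow> q k i < Suc k"
    and rs: "\<And>k i. i < n \<Longrightarrow> \<exists>r s.
      (\<forall>j<n. q k j \<le> r j \<and> r j \<le> q k j + 1) \<and> (\<forall>j<n. q k j \<le> s j \<and> s j \<le> q k j + 1) \<and>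
      f i (pt (Suc k) r) \<le> 0 \<and> 0 \<le> f i (pt (Suc k) s)"
    by metis
  have "pt (Suc k) (q k) \<in> B" for k
    using q[of _ k] by (intro pt_B) (auto intro: less_imp_le)
  \<comment> \<open>Countably many coordinates make the function space metric, so compactness yields
    a convergent subsequence.\<close>
  moreover have "seq_compact B"
    using compact_countable_box[of a b] unfolding B_def compact_eq_seq_compact_metric .
  ultimately obtain z \<phi> where z: "z \<in> B" and \<phi>: "strict_mono \<phi>"
    and lim: "(\<lambda>k. pt (Suc (\<phi> k)) (q (\<phi> k))) \<longlonglongrightarrow> z"
    using seq_compactE[of B "\<lambda>k. pt (Suc k) (q k)"] unfolding comp_def by blast
  \<comment> \<open>Any choice of vertices of the selected cells has the same limit, because side
    \<open>j\<close> of a cell has length at most \<open>(b j - a j) / Suc k\<close>.\<close>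
  have near: "(\<lambda>k. pt (Suc (\<phi> k)) (u (\<phi> k))) \<longlonglongrightarrow> z"
    if u: "\<And>k j. j < n \<Longrightarrow> q k j \<le> u k j \<and> u k j \<le> q k j + 1" for u
    unfolding tendsto_coordinatewise
  proof
    fix j
    have qlim: "(\<lambda>k. pt (Suc (\<phi> k)) (q (\<phi> k)) j) \<longlonglongrightarrow> z j"
      using lim unfolding tendsto_coordinatewise by blast
    have "(\<lambda>k. (b j - a j) * inverse (real (Suc (\<phi> k)))) \<longlonglongrightarrow> (b j - a j) * 0"
      by (intro tendsto_intros LIMSEQ_subseq_LIMSEQ[OF LIMSEQ_inverse_real_of_nat \<phi>, unfolded comp_def])
    then have "(\<lambda>k. (b j - a j) * inverse (real (Suc (\<phi> k)))) \<longlonglongrightarrow> 0"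
      by (simp only: mult_zero_right)
    then have "(\<lambda>k. pt (Suc (\<phi> k)) (u (\<phi> k)) j - pt (Suc (\<phi> k)) (q (\<phi> k)) j) \<longlonglongrightarrow> 0"
    proof (rule Lim_null_comparison[rotated])
      have "\<bar>pt (Suc k) (u k) j - pt (Suc k) (q k) j\<bar> \<le> (b j - a j) * inverse (real (Suc k))" for k
      proof (cases "j < n")
        case True
        have "pt (Suc k) (u k) j - pt (Suc k) (q k) j
            = (b j - a j) * ((real (u k j) - real (q k j)) / real (Suc k))"
          using True by (simp add: pt_def algebra_simps diff_divide_distrib)
        moreover have "\<bar>(real (u k j) - real (q k j)) / real (Suc k)\<bar> \<le> inverse (real (Suc k))"
          using u[OF True, of k] by (simp add: divide_simps)
        ultimately show ?thesis
          using ab[of j]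
          by (simp only: abs_mult)
            (simp add: mult_left_mono del: of_nat_Suc times_divide_eq_right)
      qed (use ab[of j] in \<open>simp add: pt_def\<close>)
      then show "\<forall>\<^sub>F k in sequentially. norm (pt (Suc (\<phi> k)) (u (\<phi> k)) j - pt (Suc (\<phi> k)) (q (\<phi> k)) j)
          \<le> (b j - a j) * inverse (real (Suc (\<phi> k)))"
        by simp
    qed
    from tendsto_add[OF this qlim] show "(\<lambda>k. pt (Suc (\<phi> k)) (u (\<phi> k)) j) \<longlonglongrightarrow> z j"
      by simp
  qed
  have "f i z = 0" if i: "i < n" for i
  proof -
    have bd: "\<forall>j<n. u j \<le> Suc k" if "\<And>j. j < n \<Longrightarrow> u j \<le> q k j + 1" for u k
    proof (intro allI impI)
      fix j assume "j < n"
      then show "u j \<le> Suc k" using that[of j] q[of j k] by simp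
    qed
    have flim: "(\<lambda>k. f i (pt (Suc (\<phi> k)) (u (\<phi> k)))) \<longlonglongrightarrow> f i z"
      if u: "\<And>k j. j < n \<Longrightarrow> q k j \<le> u k j \<and> u k j \<le> q k j + 1" for u
    proof (rule continuous_on_tendsto_compose[OF cont[OF i] near[OF u] z])
      show "\<forall>\<^sub>F k in sequentially. pt (Suc (\<phi> k)) (u (\<phi> k)) \<in> B"
        using u by (intro always_eventually allI pt_B bd) auto
    qed
    have "\<forall>k. \<exists>r. (\<forall>j<n. q k j \<le> r j \<and> r j \<le> q k j + 1) \<and> f i (pt (Suc k) r) \<le> 0"
      using rs[OF i] by blast
    then obtain r where r: "\<And>k j. j < n \<Longrightarrow> q k j \<le> r k j \<and> r k j \<le> q k j + 1"
      and fr: "\<And>k. f i (pt (Suc k) (r k)) \<le> 0"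
      by (metis (lifting))
    have "\<forall>k. \<exists>s. (\<forall>j<n. q k j \<le> s j \<and> s j \<le> q k j + 1) \<and> 0 \<le> f i (pt (Suc k) s)"
      using rs[OF i] by blast
    then obtain s where s: "\<And>k j. j < n \<Longrightarrow> q k j \<le> s k j \<and> s k j \<le> q k j + 1"
      and fs: "\<And>k. 0 \<le> f i (pt (Suc k) (s k))"
      by (metis (lifting))
    \<comment> \<open>The vertices \<open>r\<close> and the vertices \<open>s\<close> both tend to
      \<open>z\<close>, so both weak signs survive in the limit.\<close>
    have "f i z \<le> 0"
      using LIMSEQ_le_const2[OF flim[of r, OF r]] fr by blast
    moreover have "0 \<le> f i z"
      using LIMSEQ_le_const[OF flim[of s, OF s]] fs by blast
    ultimately show ?thesis by simp
  qed
  with z that show thesis by blast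
qed

section \<open>Chains with rearranged increments\<close>

text \<open>The corner \<open>(d, d)\<close> and the endpoint \<open>(1, 1)\<close> need not belong to \<open>S\<close>.\<close>

definition rearranged_chain :: "(real \<times> real) set \<Rightarrow> real \<Rightarrow> nat \<Rightarrow> bool" where
  "rearranged_chain S d n \<longleftrightarrow> (\<exists>(A :: nat \<Rightarrow> real \<times> real) \<sigma>.
     (\<forall>i \<in> {1..n}. A i \<in> S) \<and> A 0 = (d, d) \<and> A (n + 1) = (1, 1) \<and>
     (\<forall>i \<in> {0..n}. fst (A i) < fst (A (i + 1)) \<and> snd (A i) < snd (A (i + 1))) \<and>
     \<sigma> permutes {0..n} \<and>
     (\<forall>i \<in> {0..n}. fst (A (i + 1)) - fst (A i) = snd (A (\<sigma> i + 1)) - snd (A (\<sigma> i))))"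

lemma rearranged_chain_mono:
  "rearranged_chain S d n \<Longrightarrow> S \<subseteq> T \<Longrightarrow> rearranged_chain T d n"
  unfolding rearranged_chain_def by (meson subsetD)

lemma rearranged_chain_0: "d < 1 \<Longrightarrow> rearranged_chain S d 0"
  unfolding rearranged_chain_def
  by (intro exI[of _ "\<lambda>i. if i = 0 then (d, d) else (1, 1)"] exI[of _ id]) (simp add: permutes_id)

text \<open>Reflection in the diagonal exchanges horizontal and vertical increments, so the inverse
  permutation matches them.\<close>

lemma rearranged_chain_swap:
  assumes "rearranged_chain S d n"
  shows "rearranged_chain (prod.swap ` S) d n"
proof -
  obtain A \<sigma> where A: "\<And>i. i \<in> {1..n} \<Longrightarrow> A i \<in> S" "A 0 = (d, d)" "A (n + 1) = (1, 1)"
    "\<And>i. i \<in> {0..n} \<Longrightarrow> fst (A i) < fst (A (i + 1)) \<and> snd (A i) < snd (A (i + 1))"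
    and \<sigma>: "\<sigma> permutes {0..n}"
    and eq: "\<And>i. i \<in> {0..n} \<Longrightarrow> fst (A (i + 1)) - fst (A i) = snd (A (\<sigma> i + 1)) - snd (A (\<sigma> i))"
    using assms unfolding rearranged_chain_def by blast
  have "snd (A (i + 1)) - snd (A i) = fst (A (inv \<sigma> i + 1)) - fst (A (inv \<sigma> i))"
    if "i \<in> {0..n}" for i
  proof -
    have "inv \<sigma> i \<in> {0..n}"
      using permutes_in_image[OF permutes_inv[OF \<sigma>]] that by blast
    from eq[OF this] show ?thesis by (simp add: permutes_inverses[OF \<sigma>])
  qed
  then show ?thesis
    unfolding rearranged_chain_def using A permutes_inv[OF \<sigma>]
    by (intro exI[of _ "\<lambda>i. prod.swap (A i)"] exI[of _ "inv \<sigma>"]) auto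
qed

text \<open>The step from \<open>(d, d)\<close> to \<open>(e, e)\<close> has equal increments
  \<open>e - d\<close>. Hence the new permutation fixes 0 and acts as \<open>\<sigma>\<close> on the
  indices shifted by one.\<close>

lemma rearranged_chain_prepend:
  assumes "rearranged_chain S e n" "d < e" "(e, e) \<in> S"
  shows "rearranged_chain S d (Suc n)"
proof -
  obtain A \<sigma> where A: "\<And>i. i \<in> {1..n} \<Longrightarrow> A i \<in> S" "A 0 = (e, e)" "A (n + 1) = (1, 1)"
    "\<And>i. i \<in> {0..n} \<Longrightarrow> fst (A i) < fst (A (i + 1)) \<and> snd (A i) < snd (A (i + 1))"
    and \<sigma>: "\<sigma> permutes {0..n}"
    and eq: "\<And>i. i \<in> {0..n} \<Longrightarrow> fst (A (i + 1)) - fst (A i) = snd (A (\<sigma> i + 1)) - snd (A (\<sigma> i))"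
    using assms(1) unfolding rearranged_chain_def by blast
  define A' where "A' i = (case i of 0 \<Rightarrow> (d, d) | Suc j \<Rightarrow> A j)" for i
  define \<sigma>' where "\<sigma>' i = (case i of 0 \<Rightarrow> 0 | Suc j \<Rightarrow> Suc (\<sigma> j))" for i
  have "\<sigma>' permutes {0..Suc n}"
  proof (rule bij_imp_permutes)
    have "\<sigma>' ` insert 0 (Suc ` {0..n}) = insert 0 (Suc ` \<sigma> ` {0..n})"
      by (simp add: \<sigma>'_def image_image del: image_Suc_atLeastAtMost)
    also have "\<dots> = {0..Suc n}"
      by (simp only: permutes_image[OF \<sigma>] atLeast0_atMost_Suc_eq_insert_0)
    finally have "\<sigma>' ` {0..Suc n} = {0..Suc n}"
      by (simp only: atLeast0_atMost_Suc_eq_insert_0)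
    then show "bij_betw \<sigma>' {0..Suc n} {0..Suc n}"
      by (simp add: bij_betw_def eq_card_imp_inj_on)
    show "\<sigma>' i = i" if "i \<notin> {0..Suc n}" for i
      using that permutes_not_in[OF \<sigma>] by (auto simp: \<sigma>'_def split: nat.split)
  qed
  moreover have "A' i \<in> S" if i: "i \<in> {1..Suc n}" for i
  proof (cases "i = 1")
    case True
    then show ?thesis using A(2) assms(3) by (simp add: A'_def)
  next
    case False
    then obtain j where "i = Suc j" "j \<in> {1..n}" using i by (cases i) auto
    then show ?thesis using A(1) by (simp add: A'_def)
  qed
  moreover have "fst (A' i) < fst (A' (i + 1)) \<and> snd (A' i) < snd (A' (i + 1))"
    if "i \<in> {0..Suc n}" for i
    using that A(2,4) assms(2) by (cases i) (auto simp: A'_def)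
  moreover have "fst (A' (i + 1)) - fst (A' i) = snd (A' (\<sigma>' i + 1)) - snd (A' (\<sigma>' i))"
    if "i \<in> {0..Suc n}" for i
    using that A(2) eq by (cases i) (auto simp: A'_def \<sigma>'_def)
  moreover have "A' 0 = (d, d)" "A' (Suc n + 1) = (1, 1)"
    using A(3) by (simp_all add: A'_def)
  ultimately show ?thesis
    unfolding rearranged_chain_def by blast
qed

section \<open>Curves that avoid the diagonal\<close>

lemma cyclic_shift_permutes:
  "(\<lambda>i. if i < n then Suc i else if i = n then 0 else i) permutes {0..n}" (is "?\<sigma> permutes _")
proof (rule bij_imp_permutes)
  have "j \<in> ?\<sigma> ` {0..n}" if "j \<in> {0..n}" for j
  proof (rule image_eqI)
    show "j = ?\<sigma> (if j = 0 then n else j - 1)" "(if j = 0 then n else j - 1) \<in> {0..n}"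
      using that by auto
  qed
  moreover have "?\<sigma> j \<in> {0..n}" if "j \<in> {0..n}" for j
    using that by auto
  ultimately have "?\<sigma> ` {0..n} = {0..n}" by blast
  then show "bij_betw ?\<sigma> {0..n} {0..n}"
    by (simp add: bij_betw_def eq_card_imp_inj_on)
qed auto

text \<open>These are \<open>n + 1\<close> equations in the \<open>n + 1\<close> unknowns
  \<open>c\<close>, \<open>t 1\<close>, ..., \<open>t n\<close>. The face signs come from
  \<open>d \<le> x \<le> 1\<close> for the equation of \<open>c\<close>, and from
  \<open>y s = d\<close> and \<open>y 1 = 1\<close> for the others. The truncated system could also
  be met at parameter 1, and this has to be excluded afterwards.\<close>

lemma cyclic_shift_system:
  fixes x y :: "real \<Rightarrow> real"
  assumes "s < 1" "d < 1" "0 < n"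
    and contx: "continuous_on {s..1} x" and conty: "continuous_on {s..1} y"
    and ends: "y s = d" "x 1 = 1" "y 1 = 1"
    and x: "\<And>t. t \<in> {s..<1} \<Longrightarrow> x t \<in> {d..<1}"
    and y: "\<And>t. t \<in> {s..<1} \<Longrightarrow> y t < 1"
  obtains c t where "0 < c" "\<And>i. i \<in> {1..n} \<Longrightarrow> t i \<in> {s..<1}" "y (t 1) = d + c"
    "\<And>i. i \<in> {1..<n} \<Longrightarrow> y (t (Suc i)) = x (t i) + c" "x (t n) + c = 1"
proof -
  define a where "a i = (if i = 0 then 0 else s)" for i :: nat
  \<comment> \<open>The bound \<open>1 - d\<close> for \<open>c\<close> is the least that makes
    \<open>x (z n) + c - 1\<close> nonnegative whenever \<open>x (z n) \<ge> d\<close>.\<close>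
  define b where "b i = (if i = 0 then 1 - d else 1)" for i :: nat
  define B where "B = Pi UNIV (\<lambda>i. {a i..b i})"
  \<comment> \<open>Coordinate 0 of a point of \<open>B\<close> is \<open>c\<close>, coordinate \<open>i > 0\<close> the parameter of \<open>A\<^sub>i\<close>.
    The truncation by \<open>min 1\<close> in \<open>f\<close> secures the sign on the upper faces; it is inactive at the zero.\<close>
  define prev where "prev i z = (if i = 1 then d else x (z (i - 1)))" for i :: nat and z :: "nat \<Rightarrow> real"
  define f where "f i z = (if i = 0 then x (z n) + z 0 - 1
      else y (z i) - min 1 (prev i z + z 0))" for i z
  have x': "d \<le> x t \<and> x t \<le> 1" if "t \<in> {s..1}" for t
    using x[of t] ends \<open>d < 1\<close> that by (cases "t = 1") auto
  have B0: "0 \<le> z 0" if "z \<in> B" for z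
    using that by (auto simp: B_def a_def b_def Pi_iff dest: spec[of _ 0])
  have Bi: "z i \<in> {s..1}" if "z \<in> B" "0 < i" for z i
    using that by (auto simp: B_def a_def b_def Pi_iff dest: spec[of _ i])
  have prev: "d \<le> prev i z" if "z \<in> B" "0 < i" for z i
    using x'[OF Bi[OF that(1), of "i - 1"]] that(2) by (simp add: prev_def)
  have coord: "continuous_on B (\<lambda>z. z i)" for i
    by (rule continuous_on_subset[OF continuous_on_product_coordinates]) simp
  have cx: "continuous_on B (\<lambda>z. x (z i))" and cy: "continuous_on B (\<lambda>z. y (z i))"
    if "0 < i" for i
    using that Bi
    by (auto intro!: continuous_on_compose2[OF contx coord] continuous_on_compose2[OF conty coord])
  have contf: "continuous_on B (f i)" for i
  proof (cases "i = 0")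
    case True
    then show ?thesis
      unfolding f_def using cx[OF \<open>0 < n\<close>] coord by (auto intro!: continuous_intros)
  next
    case False
    have "continuous_on B (prev i)"
      using False cx[of "i - 1"] by (cases "i = 1") (simp_all add: prev_def[abs_def])
    then show ?thesis
      unfolding f_def using False cy[of i] coord by (auto intro!: continuous_intros)
  qed
  have lo: "f i z \<le> 0" if z: "z \<in> B" and eq: "z i = a i" for i z
  proof (cases "i = 0")
    case True
    then show ?thesis
      using x'[OF Bi[OF z \<open>0 < n\<close>]] eq by (simp add: f_def a_def)
  next
    case False
    then show ?thesis
      using prev[OF z, of i] B0[OF z] eq ends \<open>d < 1\<close> by (simp add: f_def a_def)
  qed
  have hi: "0 \<le> f i z" if z: "z \<in> B" and eq: "z i = b i" for i z
  proof (cases "i = 0")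
    case True
    then show ?thesis
      using x'[OF Bi[OF z \<open>0 < n\<close>]] eq by (simp add: f_def b_def)
  next
    case False
    then show ?thesis
      using eq ends by (simp add: f_def b_def)
  qed
  obtain z where z: "z \<in> B" and f0: "\<And>i. i < Suc n \<Longrightarrow> f i z = 0"
  proof (rule poincare_miranda[of a b "Suc n" f, folded B_def])
    show "a i \<le> b i" for i
      using assms(1,2) by (simp add: a_def b_def)
    show "continuous_on B (f i)" for i by (rule contf)
    show "f i z \<le> 0" if "z \<in> B" "z i = a i" for i z using that by (rule lo)
    show "0 \<le> f i z" if "z \<in> B" "z i = b i" for i z using that by (rule hi)
  qed (rule that)
  define c where "c = z 0"
  have last: "x (z n) + c = 1"
    using f0[of 0] by (simp add: f_def c_def)
  have step: "y (z i) = min 1 (prev i z + c)" if "i \<in> {1..n}" for i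
    using f0[of i] that by (simp add: f_def c_def)
  have y1: "t = 1" if "t \<in> {s..1}" "y t = 1" for t
    using y[of t] that by force
  have x1: "t = 1" if "t \<in> {s..1}" "x t = 1" for t
    using x[of t] that by force
  have c0: "0 \<le> c" using B0[OF z] by (simp add: c_def)
  have "z i \<noteq> 1" if i: "i \<in> {1..n}" for i
  proof
    assume "z i = 1"
    \<comment> \<open>Being at the endpoint propagates up to \<open>z n\<close>, forcing \<open>c = 0\<close>, and then down to \<open>z 1\<close>.\<close>
    with i have "z n = 1"
    proof (induction "n - i" arbitrary: i)
      case (Suc k)
      then have "y (z (Suc i)) = 1"
        using step[of "Suc i"] c0 ends by (simp add: prev_def)
      then have "z (Suc i) = 1" using y1 Bi[OF z] by blast
      then show ?case using Suc.hyps(2) Suc.prems by (intro Suc.hyps(1)[of "Suc i"]) auto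
    qed simp
    then have "c = 0" using last ends by simp
    have "z (n - k) = 1" if "k < n" for k
      using that
    proof (induction k)
      case 0
      then show ?case using \<open>z n = 1\<close> by simp
    next
      case (Suc k)
      then have "y (z (n - k)) = 1" using ends by simp
      moreover have "prev (n - k) z = x (z (n - Suc k))"
        using Suc.prems by (auto simp: prev_def)
      ultimately have "1 \<le> x (z (n - Suc k))"
        using step[of "n - k"] Suc.prems \<open>c = 0\<close> by simp
      then show ?case
        using x1[OF Bi[OF z, of "n - Suc k"]] x'[OF Bi[OF z, of "n - Suc k"]] Suc.prems by simp
    qed
    from this[of "n - 1"] have "z 1 = 1" using \<open>0 < n\<close> by simp
    \<comment> \<open>The first equation now reads \<open>1 = min 1 d\<close>, against
      \<open>d < 1\<close>.\<close>
    then show False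
      using step[of 1] \<open>c = 0\<close> \<open>0 < n\<close> ends \<open>d < 1\<close> by (simp add: prev_def)
  qed
  then have zi: "z i \<in> {s..<1}" if "i \<in> {1..n}" for i
    using Bi[OF z, of i] that by force
  \<comment> \<open>Away from parameter 1 the value of \<open>y\<close> is below 1, so the minimum
    is its second argument.\<close>
  have step': "y (z i) = prev i z + c" if "i \<in> {1..n}" for i
    using step[OF that] y[OF zi[OF that]] by simp
  show thesis
  proof (rule that)
    show "0 < c"
      using last x[OF zi[of n]] \<open>0 < n\<close> by simp
    show "y (z 1) = d + c"
      using step'[of 1] \<open>0 < n\<close> by (simp add: prev_def)
    show "y (z (Suc i)) = x (z i) + c" if "i \<in> {1..<n}" for i
      using step'[of "Suc i"] that by (simp add: prev_def)
  qed (use zi last in auto)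
qed

text \<open>If each height is the preceding abscissa plus \<open>c\<close>, then horizontal step
  \<open>i\<close> equals vertical step \<open>i + 1\<close> for \<open>i < n\<close>. The cycle
  closes because the last horizontal step and the first vertical step are both
  \<open>c\<close>.\<close>

lemma rearranged_chain_below_diagonal:
  fixes \<gamma> :: "real \<Rightarrow> real \<times> real"
  assumes "s < 1" "d < 1"
    and cont: "continuous_on {s..1} \<gamma>"
    and ends: "\<gamma> s \<in> {d..<1} \<times> {d}" "\<gamma> 1 = (1, 1)"
    and inside: "\<And>t. t \<in> {s<..<1} \<Longrightarrow> \<gamma> t \<in> {d<..<1} \<times> {d<..<1}"
    and below: "\<And>t. t \<in> {s<..<1} \<Longrightarrow> snd (\<gamma> t) < fst (\<gamma> t)"
  shows "rearranged_chain (\<gamma> ` {s..1}) d n"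
proof (cases "n = 0")
  case True
  then show ?thesis using rearranged_chain_0[OF \<open>d < 1\<close>] by simp
next
  case False
  have fst: "fst (\<gamma> t) \<in> {d..<1}" and snd: "snd (\<gamma> t) < 1" if "t \<in> {s..<1}" for t
    using that inside[of t] ends(1) \<open>d < 1\<close> by (cases "t = s"; force simp: mem_Times_iff)+
  obtain c t where c: "0 < c" and t: "\<And>i. i \<in> {1..n} \<Longrightarrow> t i \<in> {s..<1}"
    and y1: "snd (\<gamma> (t 1)) = d + c"
    and ySuc: "\<And>i. i \<in> {1..<n} \<Longrightarrow> snd (\<gamma> (t (Suc i))) = fst (\<gamma> (t i)) + c"
    and last: "fst (\<gamma> (t n)) + c = 1"
  proof (rule cyclic_shift_system[of s d n "\<lambda>t. fst (\<gamma> t)" "\<lambda>t. snd (\<gamma> t)"])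
    show "continuous_on {s..1} (\<lambda>t. fst (\<gamma> t))" "continuous_on {s..1} (\<lambda>t. snd (\<gamma> t))"
      using cont by (auto intro: continuous_intros)
  qed (use assms False fst snd in \<open>auto simp: mem_Times_iff\<close>)
  define A where "A i = (if i = 0 then (d, d) else if i \<le> n then \<gamma> (t i) else (1, 1))" for i
  \<comment> \<open>The corners are included: \<open>i = 0\<close> is the equation for
    \<open>y (t 1)\<close>, and \<open>i = n\<close> is the one for \<open>x (t n)\<close>.\<close>
  have shift: "snd (A (Suc i)) = fst (A i) + c" if i: "i \<le> n" for i
  proof -
    consider "i = 0" | "i \<in> {1..<n}" | "i = n" using i by force
    then show ?thesis
      by cases (use False y1 ySuc last in \<open>auto simp: A_def\<close>)
  qed
  have x_ge: "d \<le> fst (A i)" if "i \<le> n" for i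
    using that fst[OF t[of i]] by (auto simp: A_def)
  have incx: "fst (A i) < fst (A (Suc i))" if "i \<le> n" for i
  proof (cases "i = n")
    case True
    then show ?thesis using last c False by (simp add: A_def)
  next
    case False
    then have i: "Suc i \<in> {1..n}" using that by simp
    have A: "A (Suc i) = \<gamma> (t (Suc i))" using i by (simp add: A_def)
    \<comment> \<open>The curve is known to be strictly below the diagonal only after
      \<open>s\<close>. The point cannot be the starting point, whose height is
      \<open>d\<close>.\<close>
    have "d < snd (\<gamma> (t (Suc i)))"
      using shift[OF that] x_ge[OF that] c unfolding A by simp
    then have "t (Suc i) \<noteq> s" using ends(1) by (auto simp: mem_Times_iff)
    then have "snd (A (Suc i)) < fst (A (Suc i))"
      unfolding A using t[OF i] by (intro below) auto
    then show ?thesis using shift[OF that] c by simp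
  qed
  have incy: "snd (A i) < snd (A (Suc i))" if "i \<le> n" for i
  proof (cases i)
    case 0
    then show ?thesis using shift[of 0] c by (simp add: A_def)
  next
    \<comment> \<open>Vertical step \<open>i\<close> equals horizontal step \<open>j\<close>, which
      is positive by \<open>incx\<close>.\<close>
    case (Suc j)
    then show ?thesis using shift[of j] shift[of i] incx[of j] that by simp
  qed
  define \<sigma> where "\<sigma> = (\<lambda>i. if i < n then Suc i else if i = n then 0 else i)"
  have "fst (A (i + 1)) - fst (A i) = snd (A (\<sigma> i + 1)) - snd (A (\<sigma> i))" if "i \<le> n" for i
  proof (cases "i = n")
    case True
    then show ?thesis using shift[of 0] last False by (simp add: \<sigma>_def A_def)
  next
    case False
    then show ?thesis using shift[of i] shift[of "Suc i"] that by (simp add: \<sigma>_def)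
  qed
  moreover have "A i \<in> \<gamma> ` {s..1}" if "i \<in> {1..n}" for i
    using t[OF that] that by (auto simp: A_def)
  moreover have "\<sigma> permutes {0..n}"
    unfolding \<sigma>_def by (rule cyclic_shift_permutes)
  moreover have "A 0 = (d, d)" "A (n + 1) = (1, 1)" by (simp_all add: A_def)
  ultimately show ?thesis
    unfolding rearranged_chain_def using incx incy
    by (intro exI[of _ A] exI[of _ \<sigma>]) simp
qed

text \<open>The difference of the coordinates has no zero on a connected interval, hence has
  constant sign there. The case above the diagonal follows by reflection.\<close>

lemma rearranged_chain_off_diagonal:
  fixes \<gamma> :: "real \<Rightarrow> real \<times> real"
  assumes "s < 1" "d < 1"
    and cont: "continuous_on {s..1} \<gamma>"
    and ends: "\<gamma> s \<in> {d} \<times> {d..<1} \<union> {d..<1} \<times> {d}" "\<gamma> 1 = (1, 1)"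
    and inside: "\<And>t. t \<in> {s<..<1} \<Longrightarrow> \<gamma> t \<in> {d<..<1} \<times> {d<..<1}"
    and off: "\<And>t. t \<in> {s<..<1} \<Longrightarrow> fst (\<gamma> t) \<noteq> snd (\<gamma> t)"
  shows "rearranged_chain (\<gamma> ` {s..1}) d n"
proof -
  define h where "h t = fst (\<gamma> t) - snd (\<gamma> t)" for t
  have conth: "continuous_on {s..1} h"
    unfolding h_def using cont by (auto intro!: continuous_intros)
  have "h ` {s<..<1} \<subseteq> {0<..} \<or> h ` {s<..<1} \<subseteq> {..<0}"
  proof -
    have "connected (h ` {s<..<1})"
      by (intro connected_continuous_image continuous_on_subset[OF conth]) auto
    moreover have "0 \<notin> h ` {s<..<1}" using off by (auto simp: h_def)
    ultimately have "\<not> (\<exists>u\<in>h ` {s<..<1}. \<exists>v\<in>h ` {s<..<1}. u < 0 \<and> 0 < v)"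
      by (metis connected_iff_interval less_imp_le)
    then show ?thesis
      using \<open>0 \<notin> h ` {s<..<1}\<close> by (force simp: not_less order_le_less)
  qed
  \<comment> \<open>The weak sign passes to the limit at \<open>s\<close>. It decides on which of
    the two sides of the square the curve starts; the corner \<open>(d, d)\<close> lies on
    both.\<close>
  moreover have start: "h s \<in> closure (h ` {s<..<1})"
  proof -
    have "closure {s<..<1} = {s..1}" using \<open>s < 1\<close> by simp
    then have "h ` {s..1} \<subseteq> closure (h ` {s<..<1})"
      using image_closure_subset[of "{s<..<1}" h "closure (h ` {s<..<1})"] conth
        closure_subset[of "h ` {s<..<1}"]
      by simp
    then show ?thesis using \<open>s < 1\<close> by auto
  qed
  ultimately consider
      (below) "\<And>t. t \<in> {s<..<1} \<Longrightarrow> 0 < h t" "0 \<le> h s"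
    | (above) "\<And>t. t \<in> {s<..<1} \<Longrightarrow> h t < 0" "h s \<le> 0"
  proof (elim disjE)
    assume *: "h ` {s<..<1} \<subseteq> {0<..}"
    then have "0 \<le> h s" using start closure_mono[OF *] by auto
    with * show thesis by (intro that(1)) (force simp: image_subset_iff)+
  next
    assume *: "h ` {s<..<1} \<subseteq> {..<0}"
    then have "h s \<le> 0" using start closure_mono[OF *] by auto
    with * show thesis by (intro that(2)) (force simp: image_subset_iff)+
  qed
  then show ?thesis
  proof cases
    case below
    have "\<gamma> s \<in> {d..<1} \<times> {d}"
      using ends(1) below(2) by (auto simp: mem_Times_iff h_def)
    then show ?thesis
      using assms(1-3) ends(2) inside below(1)
      by (intro rearranged_chain_below_diagonal) (auto simp: h_def)
  next
    case above
    have "rearranged_chain ((\<lambda>t. prod.swap (\<gamma> t)) ` {s..1}) d n"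
    proof (rule rearranged_chain_below_diagonal)
      show "prod.swap (\<gamma> s) \<in> {d..<1} \<times> {d}"
        using ends(1) above(2) by (auto simp: mem_Times_iff h_def)
      show "continuous_on {s..1} (\<lambda>t. prod.swap (\<gamma> t))"
        unfolding prod.swap_def using cont by (auto intro!: continuous_intros)
      show "snd (prod.swap (\<gamma> t)) < fst (prod.swap (\<gamma> t))" if "t \<in> {s<..<1}" for t
        using above(1)[OF that] by (simp add: h_def)
    qed (use assms(1,2) ends(2) inside in \<open>auto simp: mem_Times_iff\<close>)
    from rearranged_chain_swap[OF this] show ?thesis
      by (simp add: image_image)
  qed
qed

section \<open>Induction over shrinking squares\<close>

lemma rearranged_chain_exists:
  fixes \<gamma> :: "real \<Rightarrow> real \<times> real"
  assumes "s < 1" "d < 1"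
    and cont: "continuous_on {s..1} \<gamma>"
    and ends: "\<gamma> s \<in> {d} \<times> {d..<1} \<union> {d..<1} \<times> {d}" "\<gamma> 1 = (1, 1)"
    and inside: "\<And>t. t \<in> {s<..<1} \<Longrightarrow> \<gamma> t \<in> {d<..<1} \<times> {d<..<1}"
  shows "rearranged_chain (\<gamma> ` {s..1}) d n"
  using assms
\<comment> \<open>\<open>s\<close> and \<open>d\<close> must vary, since the step restarts the curve
  later and in the smaller square with corner \<open>(e, e)\<close>.\<close>
proof (induction n arbitrary: s d)
  case 0
  then show ?case by (simp add: rearranged_chain_0)
next
  case (Suc n)
  note cont = Suc.prems(3) and ends = Suc.prems(4,5) and inside = Suc.prems(6)
  show ?case
  proof (cases "\<exists>t\<in>{s<..<1}. fst (\<gamma> t) = snd (\<gamma> t)")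
    case False
    then show ?thesis
      using rearranged_chain_off_diagonal[OF Suc.prems] by blast
  next
    case True
    then obtain t e where t: "t \<in> {s<..<1}" and e: "\<gamma> t = (e, e)"
      by (metis prod.collapse)
    have de: "d < e" "e < 1" using inside[OF t] e by auto
    \<comment> \<open>\<open>h r\<close> is positive exactly when both coordinates exceed
      \<open>e\<close>. It vanishes exactly on the two rays that leave \<open>(e, e)\<close> to the
      right and upwards.\<close>
    define h where "h r = min (fst (\<gamma> r)) (snd (\<gamma> r)) - e" for r
    have conth: "continuous_on {t..1} h"
      unfolding h_def using continuous_on_subset[OF cont, of "{t..1}"] t
      by (auto intro!: continuous_intros)
    define Z where "Z = {r \<in> {t..1}. h r = 0}"
    have "t \<in> Z" using t e by (simp add: Z_def h_def)
    moreover have "compact Z"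
    proof -
      have "closed Z"
        unfolding Z_def using continuous_closed_preimage_constant[OF conth] by simp
      moreover have "Z \<inter> {t..1} = Z" by (auto simp: Z_def)
      ultimately show ?thesis using closed_Int_compact[of Z "{t..1}"] by simp
    qed
    ultimately obtain s' where s': "s' \<in> Z" and max: "\<And>r. r \<in> Z \<Longrightarrow> r \<le> s'"
      using compact_attains_sup[of Z] by blast
    have "s' \<noteq> 1" using s' ends(2) de by (auto simp: Z_def h_def)
    with s' have s'1: "s' < 1" "t \<le> s'" and hs': "h s' = 0" by (auto simp: Z_def)
    \<comment> \<open>A value \<open>h r \<le> 0\<close> after \<open>s'\<close> would force a zero
      between \<open>r\<close> and 1, as \<open>h 1 = 1 - e > 0\<close>, and \<open>s'\<close> is
      the last zero.\<close>
    have pos: "0 < h r" if r: "r \<in> {s'<..<1}" for r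
    proof (rule ccontr)
      assume "\<not> 0 < h r"
      moreover have "0 \<le> h 1" using ends(2) de by (simp add: h_def)
      moreover have "continuous_on {r..1} h"
        using r s'1 by (intro continuous_on_subset[OF conth]) auto
      ultimately obtain q where "r \<le> q" "q \<le> 1" "h q = 0"
        using IVT'[of h r 0 1] r by force
      then have "q \<in> Z" using r s'1 by (auto simp: Z_def)
      then show False using max[of q] \<open>r \<le> q\<close> r by simp
    qed
    have ins: "\<gamma> r \<in> {d<..<1} \<times> {d<..<1}" if "r \<in> {s'..<1}" for r
      using that t s'1 by (intro inside) auto
    have "rearranged_chain (\<gamma> ` {s'..1}) e n"
    proof (rule Suc.IH)
      show "continuous_on {s'..1} \<gamma>"
        using s'1 t by (intro continuous_on_subset[OF cont]) auto
      show "\<gamma> s' \<in> {e} \<times> {e..<1} \<union> {e..<1} \<times> {e}"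
        using hs' ins[of s'] s'1 by (auto simp: h_def mem_Times_iff min_def split: if_splits)
      show "\<gamma> r \<in> {e<..<1} \<times> {e<..<1}" if "r \<in> {s'<..<1}" for r
        using pos[OF that] ins[of r] that by (auto simp: h_def mem_Times_iff)
    qed (use s'1 de ends in auto)
    then have "rearranged_chain (\<gamma> ` {s..1}) e n"
      by (rule rearranged_chain_mono) (use s'1 t in auto)
    moreover have "(e, e) \<in> \<gamma> ` {s..1}"
      using e t by (metis atLeastAtMost_iff greaterThanLessThan_iff image_eqI less_imp_le)
    ultimately show ?thesis
      using de(1) by (intro rearranged_chain_prepend)
  qed
qed

theorem theorem1:
  fixes \<gamma> :: "real \<Rightarrow> real \<times> real" and n :: nat
  assumes cont: "continuous_on {0..1} \<gamma>"
    and range: "\<gamma> ` {0..1} \<subseteq> {0..1} \<times> {0..1}"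
    and start: "\<gamma> 0 = (0, 0)"
    and finish: "\<gamma> 1 = (1, 1)"
    and inside: "\<And>t. t \<in> {0<..<1} \<Longrightarrow> \<gamma> t \<in> {0<..<1} \<times> {0<..<1}"
  shows "\<exists>A :: nat \<Rightarrow> real \<times> real. \<exists>\<sigma> :: nat \<Rightarrow> nat.
           (\<forall>i \<in> {0..n+1}. A i \<in> \<gamma> ` {0..1}) \<and>
           A 0 = (0, 0) \<and> A (n + 1) = (1, 1) \<and>
           (\<forall>i \<in> {0..n}. fst (A (i + 1) - A i) > 0 \<and> snd (A (i + 1) - A i) > 0) \<and>
           \<sigma> permutes {0..n} \<and>
           (\<forall>i \<in> {0..n}. fst (A (i + 1) - A i) = snd (A (\<sigma> i + 1) - A (\<sigma> i)))"
proof -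
  have "rearranged_chain (\<gamma> ` {0..1}) 0 n"
    using cont start finish inside by (intro rearranged_chain_exists) auto
  then obtain A \<sigma> where A: "\<And>i. i \<in> {1..n} \<Longrightarrow> A i \<in> \<gamma> ` {0..1}"
    "A 0 = (0, 0)" "A (n + 1) = (1, 1)"
    "\<And>i. i \<in> {0..n} \<Longrightarrow> fst (A i) < fst (A (i + 1)) \<and> snd (A i) < snd (A (i + 1))"
    "\<sigma> permutes {0..n}"
    "\<And>i. i \<in> {0..n} \<Longrightarrow> fst (A (i + 1)) - fst (A i) = snd (A (\<sigma> i + 1)) - snd (A (\<sigma> i))"
    unfolding rearranged_chain_def by blast
  \<comment> \<open>The chain places only its inner points on the curve; the two ends lie there by
    \<open>start\<close> and \<open>finish\<close>.\<close>
  have "A i \<in> \<gamma> ` {0..1}" if i: "i \<in> {0..n + 1}" for i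
  proof -
    consider "i = 0" | "i \<in> {1..n}" | "i = n + 1" using i by force
    then show ?thesis
    proof cases
      case 1
      then show ?thesis using A(2) start by (intro image_eqI[of _ _ 0]) auto
    next
      case 3
      then show ?thesis using A(3) finish by (intro image_eqI[of _ _ 1]) auto
    qed (rule A(1))
  qed
  then show ?thesis
    using A(2-6)
    by (intro exI[of _ A] exI[of _ \<sigma>]) (simp only: fst_diff snd_diff diff_gt_0_iff_gt, blast)
qed

end
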